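(* Let $\mathcal C$ be an $n$-qubit XP-regular code of precision $N$ with code projector $\Pi_{\mathcal C}$ and $K=\dim\mathcal C$, and let $\Pi_Z\ge\Pi_{\mathcal C}$ be the projector onto the subspace fixed by the diagonal stabilizers of $\mathcal C$. Let $\{\mathcal K_{\mathbf i}\}$ be the Kraus operators of the $n$-qubit error channel which is the $n$-fold tensor power of a single-qubit channel. Let $E_{s_z}$ be a unitary error operator, $E_{s_x}$ a diagonal unitary error operator, and put $\Pi_{s_z}=E_{s_z}\Pi_ZE_{s_z}^\dagger$ and $\Pi_{s_x}=E_{s_x}\Pi_{\mathcal C}E_{s_x}^\dagger$. Let $\bar L$ be a unitary logical operator of $\mathcal C$, $\tilde E_s=E_{s_z}E_{s_x}\bar L$ and $\Pi_s=\tilde E_s\Pi_{\mathcal C}\tilde E_s^\dagger$. Then the probability $$p(\bar L\cap s_{x,z},E_{s_{x,z}})=\int d\mu(|\tilde\psi\rangle)\sum_{\mathbf i}\mathrm{Tr}\big[\bar L|\tilde\psi\rangle\langle\tilde\psi|\bar L^\dagger E_{s_x}^\dagger\Pi_{s_x}E_{s_z}^\dagger\Pi_{s_z}\mathcal K_{\mathbf i}|\tilde\psi\rangle\langle\tilde\psi|\mathcal K_{\mathbf i}^\dagger\Pi_{s_z}E_{s_z}\Pi_{s_x}E_{s_x}\big]$$ of incurring the logical error $\bar L$ in the two-round error correction procedure equals $$\frac{1}{K(K+1)}\Big(\sum_{\mathbf i}\mathrm{Tr}[\mathcal K_{\mathbf i}\Pi_{\mathcal C}\mathcal K_{\mathbf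 i}^\dagger\Pi_s]+\sum_{\mathbf i}\mathrm{Tr}[\mathcal K_{\mathbf i}\Pi_{\mathcal C}\tilde E_s^\dagger]\,\mathrm{Tr}[\mathcal K_{\mathbf i}^\dagger\tilde E_s\Pi_{\mathcal C}]\Big).$$
   Context: XP codes: for an integer $N\ge2$ let $\omega=e^{i\pi/N}$, $P=\mathrm{diag}(1,\omega^2)$. XP operators of precision $N$ are $XP_N(\mathbf x|\mathbf z|p)=\omega^p\bigotimes_iX^{\mathbf x[i]}P^{\mathbf z[i]}$ with $\mathbf x\in\mathbb Z_2^n$, $\mathbf z\in\mathbb Z_N^n$, $p\in\mathbb Z_{2N}$. A subgroup $\mathcal S$ of XP operators defines the XP stabilizer code $\mathcal C=\{|\psi\rangle:g|\psi\rangle=|\psi\rangle\ \forall g\in\mathcal S\}$, assumed nonzero. An operator is diagonal if it is diagonal in the computational basis. $\Pi_Z$ is the projector onto the common $+1$ eigenspace of the diagonal elements of $\mathcal S$; it is diagonal in the computational basis. The code is XP-regular if the set $E\subset\mathbb F_2^n$ of computational basis labels $\mathbf e$ with $\langle\mathbf e|\psi\rangle\ne0$ for some $|\psi\rangle\in\mathcal C$ has the form $\mathbf q+\langle S_X\rangle+\langle L_X\rangle$ (a single coset), where $S_X$, $L_X$ are the sets of $X$-parts $\mathbf x$ of the non-diagonal generators of $\mathcal S$ and of the non-diagonal logical operators, respectively. A unitary logical operator $\bar L$ is a unitary preserving $\mathcal C$, i.e. $\bar L\Pi_{\mathcal C}=\Pi_{\mathcal C}\bar L$. Error channel: if the single-qubit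 channel is $\rho\mapsto\sum_{i=1}^4K_i\rho K_i^\dagger$, then $\mathcal K_{\mathbf i}=K_{i_1}\otimes\cdots\otimes K_{i_n}$ for $\mathbf i\in\{1,2,3,4\}^n$. $\mu$ is the normalized uniform (unitarily invariant) probability measure on unit vectors $|\tilde\psi\rangle\in\mathcal C$. *)

theory Defs
  imports
    "HOL-Probability.Probability"
    "HOL-Algebra.Generated_Groups"
    "HOL-Library.Z2"
begin

instance bit :: finite
proof
  have "(UNIV :: bit set) \<subseteq> {0, 1}" by auto
  then show "finite (UNIV :: bit set)" by (rule finite_subset) simp
qed

text \<open>
  An $n$-qubit system is indexed by a finite type \<open>'n\<close> with $n$ elements. A computational
  basis label is an element of \<open>bit ^ 'n\<close>, so that \<open>vec.span\<close> on labels is the span over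
  the field with two elements. Note that \<open>*\<close> and \<open>^\<close> on matrices
  act entrywise in the library; the matrix product is \<open>**\<close>.
\<close>

type_synonym 'n state = "complex ^ (bit ^ 'n)"
type_synonym 'n operator = "complex ^ (bit ^ 'n) ^ (bit ^ 'n)"
type_synonym qubit_op = "complex ^ bit ^ bit"

definition dagger :: "complex ^ 'a ^ 'b \<Rightarrow> complex ^ 'b ^ 'a"  ("_\<^sup>\<dagger>" [1000] 999)
  where "A\<^sup>\<dagger> = (\<chi> i j. cnj (A $ j $ i))"

definition is_unitary :: "complex ^ 'a ^ 'a \<Rightarrow> bool"
  where "is_unitary U \<longleftrightarrow> U ** U\<^sup>\<dagger> = mat 1 \<and> U\<^sup>\<dagger> ** U = mat 1"

definition is_diagonal :: "complex ^ 'a ^ 'a \<Rightarrow> bool"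
  where "is_diagonal A \<longleftrightarrow> (\<forall>i j. i \<noteq> j \<longrightarrow> A $ i $ j = 0)"

definition ketbra :: "complex ^ 'a \<Rightarrow> complex ^ 'a ^ 'a"
  where "ketbra \<psi> = (\<chi> i j. \<psi> $ i * cnj (\<psi> $ j))"

definition mat_pow :: "complex ^ 'a ^ 'a \<Rightarrow> nat \<Rightarrow> complex ^ 'a ^ 'a"
  where "mat_pow A k = (((**) A) ^^ k) (mat 1)"

definition tensor :: "('n::finite \<Rightarrow> qubit_op) \<Rightarrow> 'n operator"
  where "tensor A = (\<chi> e f. \<Prod>k\<in>UNIV. A k $ (e $ k) $ (f $ k))"

definition is_projector_onto :: "complex ^ 'a ^ 'a \<Rightarrow> (complex ^ 'a) set \<Rightarrow> bool"
  where "is_projector_onto Q V \<longleftrightarrow> Q ** Q = Q \<and> Q\<^sup>\<dagger> = Q \<and> range ((*v) Q) = V"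

definition projector :: "(complex ^ 'a) set \<Rightarrow> complex ^ 'a ^ 'a"
  where "projector V = (THE Q. is_projector_onto Q V)"

text \<open>\<open>projector V\<close> is well defined for every complex subspace \<open>V\<close>.\<close>

lemma dagger_mult: "(A ** B)\<^sup>\<dagger> = B\<^sup>\<dagger> ** A\<^sup>\<dagger>"
  by (simp add: dagger_def matrix_matrix_mult_def vec_eq_iff mult.commute)

lemma is_projector_onto_fix:
  assumes "is_projector_onto Q V" "v \<in> V"
  shows "Q *v v = v"
  using assms unfolding is_projector_onto_def
  by (metis imageE matrix_vector_mul_assoc)

lemma is_projector_onto_absorb:
  assumes "is_projector_onto P V" "is_projector_onto Q V"
  shows "P ** Q = Q"
proof -
  have "(P ** Q) *v x = Q *v x" for x
    using is_projector_onto_fix[OF assms(1)] assms(2)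
    by (metis is_projector_onto_def matrix_vector_mul_assoc rangeI)
  then show ?thesis by (simp add: matrix_eq)
qed

lemma is_projector_onto_unique:
  assumes "is_projector_onto P V" "is_projector_onto Q V"
  shows "P = Q"
  by (metis assms dagger_mult is_projector_onto_absorb is_projector_onto_def)

lemma is_projector_onto_exists:
  fixes V :: "(complex ^ 'a::finite) set"
  assumes V: "vec.subspace V"
  shows "\<exists>Q. is_projector_onto Q V"
proof -
  define ip where "ip v w = (\<Sum>k\<in>UNIV. v $ k * cnj (w $ k))" for v w :: "complex ^ 'a"
  have Re_ip: "Re (ip v w) = v \<bullet> w" for v w
    by (simp add: ip_def inner_vec_def inner_complex_def)
  have ip_add: "ip (v + v') w = ip v w + ip v' w" for v v' w
    by (simp add: ip_def distrib_right sum.distrib)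
  have ip_diff: "ip (v - v') w = ip v w - ip v' w" for v v' w
    by (simp add: ip_def left_diff_distrib sum_subtractf)
  have ip_scale: "ip (c *s v) w = c * ip v w" for c v w
    by (simp add: ip_def sum_distrib_left mult.assoc)
  have ip_scale2: "ip v (c *s w) = cnj c * ip v w" for c v w
    by (simp add: ip_def sum_distrib_left mult_ac)
  have ip_cnj: "ip v w = cnj (ip w v)" for v w
    by (simp add: ip_def mult.commute)
  have ip_sum: "ip (\<Sum>j\<in>UNIV. f j) w = (\<Sum>j\<in>UNIV. ip (f j) w)" for f :: "'a \<Rightarrow> _" and w
    unfolding ip_def by (subst sum.swap) (simp add: sum_distrib_right)
  have ip_self: "v = 0" if "ip v v = 0" for v
    using Re_ip[of v v] that by simp
  have scaleR_eq: "c *\<^sub>R v = complex_of_real c *s v" for c and v :: "complex ^ 'a"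
    unfolding vec_eq_iff vector_scaleR_component vector_smult_component
    by (simp add: scaleR_conv_of_real)
  have "subspace V"
    using V by (simp add: subspace_def vec.subspace_def scaleR_eq)
  then have spanV: "span V = V" by (simp add: span_eq_iff)
  have "\<exists>y\<in>V. \<forall>w\<in>V. ip (x - y) w = 0" for x
  proof -
    obtain y z where y: "y \<in> V" and z: "\<And>w. w \<in> V \<Longrightarrow> orthogonal z w" and x: "x = y + z"
      using orthogonal_subspace_decomp_exists[of V x] unfolding spanV by metis
    have "ip z w = 0" if w: "w \<in> V" for w
    proof -
      have "\<i> *s w \<in> V" using V w by (simp add: vec.subspace_scale)
      then have "Re (ip z (\<i> *s w)) = 0" and "Re (ip z w) = 0"
        using z w by (simp_all add: Re_ip orthogonal_def)
      then show ?thesis by (simp add: ip_scale2 complex_eq_iff)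
    qed
    then show ?thesis using y x by (intro bexI[of _ y]) simp_all
  qed
  then obtain y where yV: "\<And>x. y x \<in> V" and yo: "\<And>x w. w \<in> V \<Longrightarrow> ip (x - y x) w = 0"
    by metis
  define Q where "Q = (\<chi> i j. y (axis j 1) $ i)"
  have Qv: "Q *v v = (\<Sum>j\<in>UNIV. (v $ j) *s y (axis j 1))" for v
    by (simp add: Q_def matrix_vector_mult_def vec_eq_iff sum_component mult.commute)
  have v: "v = (\<Sum>j\<in>UNIV. (v $ j) *s axis j 1)" for v :: "complex ^ 'a"
    by (simp add: basis_expansion)
  have QV: "Q *v v \<in> V" for v
    unfolding Qv by (intro vec.subspace_sum vec.subspace_scale V yV)
  have Qo: "ip (v - Q *v v) w = 0" if w: "w \<in> V" for v w
  proof -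
    have "v - Q *v v = (\<Sum>j\<in>UNIV. (v $ j) *s (axis j 1 - y (axis j 1)))"
      by (subst v[of v]) (simp add: Qv sum_subtractf vec.scale_right_diff_distrib)
    then show ?thesis by (simp only: ip_sum ip_scale yo[OF w] mult_zero_right sum.neutral_const)
  qed
  have Qfix: "Q *v v = v" if "v \<in> V" for v
  proof -
    have "v - Q *v v \<in> V" using that QV V by (simp add: vec.subspace_diff)
    from Qo[OF this, of v] have "v - Q *v v = 0" by (rule ip_self)
    then show ?thesis by simp
  qed
  have "Q ** Q = Q"
    unfolding matrix_eq matrix_vector_mul_assoc[symmetric] using QV Qfix by blast
  moreover have "range ((*v) Q) = V"
  proof
    show "V \<subseteq> range ((*v) Q)" using Qfix by (metis rangeI subsetI)
  qed (use QV in blast)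
  moreover have "Q\<^sup>\<dagger> = Q"
  proof -
    have e: "ip (Q *v a) b = ip a (Q *v b)" for a b
    proof -
      have "ip (a - Q *v a) (Q *v b) = 0" "ip (b - Q *v b) (Q *v a) = 0"
        using Qo QV by blast+
      then show ?thesis
        by (metis ip_diff ip_cnj eq_iff_diff_eq_0)
    qed
    have "cnj (Q $ j $ i) = Q $ i $ j" for i j
    proof -
      have "ip v (axis i 1) = v $ i" "ip (axis i 1) v = cnj (v $ i)" for v i
        by (simp_all add: ip_def axis_def if_distrib if_distribR cong: if_cong)
      moreover have "(Q *v axis j 1) $ i = Q $ i $ j" for i j
        by (simp add: matrix_vector_mult_def axis_def if_distrib cong: if_cong)
      ultimately show ?thesis using e[of "axis j 1" "axis i 1"] by metis
    qed
    then show ?thesis by (simp add: dagger_def vec_eq_iff)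
  qed
  ultimately show ?thesis unfolding is_projector_onto_def by blast
qed

lemma projector_correct:
  assumes "vec.subspace V"
  shows "is_projector_onto (projector V) V"
  unfolding projector_def
  using is_projector_onto_exists[OF assms] is_projector_onto_unique by (metis theI)

definition xp_omega :: "nat \<Rightarrow> complex"
  where "xp_omega N = cis (pi / real N)"

definition X_gate :: qubit_op
  where "X_gate = (\<chi> a b. if a = b then 0 else 1)"

definition P_gate :: "nat \<Rightarrow> qubit_op"
  where "P_gate N = (\<chi> a b. if a \<noteq> b then 0 else if a = 0 then 1 else (xp_omega N)\<^sup>2)"

text \<open>Elements of the integers modulo $N$ (and modulo $2N$) are given by their least
  nonnegative representatives.\<close>

definition XP :: "nat \<Rightarrow> bit ^ 'n \<Rightarrow> nat ^ 'n \<Rightarrow> nat \<Rightarrow> ('n::finite) operator"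
  where "XP N x z p =
    (\<chi> e f. xp_omega N ^ p *
       tensor (\<lambda>k. mat_pow X_gate (if x $ k = 1 then 1 else 0) ** mat_pow (P_gate N) (z $ k)) $ e $ f)"

definition xp_params :: "nat \<Rightarrow> ((bit ^ 'n) \<times> (nat ^ 'n) \<times> nat) set"
  where "xp_params N = {(x, z, p). (\<forall>k. z $ k < N) \<and> p < 2 * N}"

definition xp_ops :: "nat \<Rightarrow> ('n::finite) operator set"
  where "xp_ops N = {XP N x z p | x z p. (x, z, p) \<in> xp_params N}"

definition xp_group :: "nat \<Rightarrow> ('n::finite) operator monoid"
  where "xp_group N = \<lparr>carrier = xp_ops N, monoid.mult = (**), one = mat 1\<rparr>"

definition fixed_space :: "(complex ^ 'a ^ 'a) set \<Rightarrow> (complex ^ 'a) set"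
  where "fixed_space S = {\<psi>. \<forall>g\<in>S. g *v \<psi> = \<psi>}"

lemma subspace_fixed_space: "vec.subspace (fixed_space S)"
  by (simp add: vec.subspace_def fixed_space_def matrix_vector_right_distrib vec.scale)

definition unitary_logical :: "(complex ^ 'a) set \<Rightarrow> complex ^ 'a ^ 'a \<Rightarrow> bool"
  where "unitary_logical C L \<longleftrightarrow> is_unitary L \<and> L ** projector C = projector C ** L"

definition nondiag_X_parts :: "nat \<Rightarrow> ('n::finite) operator set \<Rightarrow> (bit ^ 'n) set"
  where "nondiag_X_parts N A =
    {x. \<exists>z p. (x, z, p) \<in> xp_params N \<and> XP N x z p \<in> A \<and> \<not> is_diagonal (XP N x z p)}"

definition code_support :: "(complex ^ 'a) set \<Rightarrow> 'a set"
  where "code_support C = {e. \<exists>\<psi>\<in>C. \<psi> $ e \<noteq> 0}"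

text \<open>The condition does not depend on the generating set \<open>G\<close>: the $X$-part is additive
  under multiplication of XP operators, so the $X$-parts of \<open>G\<close> and of \<open>S\<close> have the same span.\<close>

definition xp_regular :: "nat \<Rightarrow> ('n::finite) operator set \<Rightarrow> bool"
  where "xp_regular N S \<longleftrightarrow>
    (\<exists>G q. G \<subseteq> S \<and> generate (xp_group N) G = S \<and>
       code_support (fixed_space S) =
         {q + s + l | s l.
            s \<in> vec.span (nondiag_X_parts N G) \<and>
            l \<in> vec.span (nondiag_X_parts N {L \<in> xp_ops N. unitary_logical (fixed_space S) L})})"

definition is_channel :: "(4 \<Rightarrow> qubit_op) \<Rightarrow> bool"
  where "is_channel K \<longleftrightarrow> (\<Sum>i\<in>UNIV. (K i)\<^sup>\<dagger> ** K i) = mat 1"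

definition kraus_tensor :: "(4 \<Rightarrow> qubit_op) \<Rightarrow> 4 ^ 'n \<Rightarrow> ('n::finite) operator"
  where "kraus_tensor K i = tensor (\<lambda>k. K (i $ k))"

text \<open>The unitaries preserving \<open>C\<close> act transitively on the unit sphere of \<open>C\<close>, so for a
  nonzero subspace \<open>C\<close> there is exactly one such measure. It lives on the ambient space and is
  concentrated on the unit vectors of \<open>C\<close>.\<close>

definition uniform_state_measure :: "(complex ^ 'a) set \<Rightarrow> (complex ^ 'a::finite) measure \<Rightarrow> bool"
  where "uniform_state_measure C \<mu> \<longleftrightarrow>
    prob_space \<mu> \<and> sets \<mu> = sets borel \<and>
    (AE \<psi> in \<mu>. \<psi> \<in> C \<and> norm \<psi> = 1) \<and>
    (\<forall>U. is_unitary U \<and> ((*v) U) ` C = C \<longrightarrow> distr \<mu> borel ((*v) U) = \<mu>)"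

end

theory Submission
  imports Defs
begin

text \<open>
  The projector \<open>\<Pi>\<^sub>Z\<close> is diagonal, so it commutes with \<open>E\<^sub>s\<^sub>x\<close> and is absorbed by \<open>\<Pi>\<^sub>C\<close>. On
  code states the integrand is thus the sum over \<open>i\<close> of
  \<open>\<langle>\<psi>|E\<^sub>s\<^sup>\<dagger> K\<^sub>i|\<psi>\<rangle> \<langle>\<psi>|K\<^sub>i\<^sup>\<dagger> E\<^sub>s|\<psi>\<rangle>\<close>, and only the fourth moments of the uniform measure are
  needed. Householder reflections act transitively on the unit sphere of \<open>C\<close> up to phases, so
  \<open>\<integral> |\<langle>v|\<psi>\<rangle>|\<^sup>4 d\<mu> = m \<langle>v|\<Pi>\<^sub>C|v\<rangle>\<^sup>2\<close> for some constant \<open>m\<close>. Polarization recovers all fourth moments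
  from this identity, and contracting them with \<open>tr \<Pi>\<^sub>C = d\<close> gives \<open>m = 2 / (d (d + 1))\<close>.
\<close>

section \<open>The Hermitian inner product\<close>

text \<open>Dirac's bracket, conjugate-linear in the first argument, so that
  \<open>cinner v (A *v v)\<close> is the expectation value of \<open>A\<close> in the state
  \<open>v\<close>.\<close>

definition cinner :: "complex ^ 'a::finite \<Rightarrow> complex ^ 'a \<Rightarrow> complex"
  where "cinner v w = (\<Sum>k\<in>UNIV. cnj (v $ k) * w $ k)"

lemma cinner_add_right: "cinner u (v + w) = cinner u v + cinner u w"
  by (simp add: cinner_def distrib_left sum.distrib)

lemma cinner_add_left: "cinner (u + v) w = cinner u w + cinner v w"
  by (simp add: cinner_def distrib_right sum.distrib)

lemma cinner_scale_right: "cinner u (c *s v) = c * cinner u v"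
  by (simp add: cinner_def sum_distrib_left mult_ac)

lemma cinner_scale_left: "cinner (c *s u) v = cnj c * cinner u v"
  by (simp add: cinner_def sum_distrib_left mult_ac)

lemma cinner_diff_right: "cinner u (v - w) = cinner u v - cinner u w"
  by (simp add: cinner_def right_diff_distrib sum_subtractf)

lemma cinner_diff_left: "cinner (u - v) w = cinner u w - cinner v w"
  by (simp add: cinner_def left_diff_distrib sum_subtractf)

lemma cinner_commute: "cinner v w = cnj (cinner w v)"
  by (simp add: cinner_def mult.commute)

lemma cinner_self: "cinner v v = complex_of_real ((norm v)\<^sup>2)"
proof -
  have "(norm v)\<^sup>2 = (\<Sum>k\<in>UNIV. (norm (v $ k))\<^sup>2)"
    by (simp add: norm_vec_def L2_set_def sum_nonneg)
  then show ?thesis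
    by (simp add: cinner_def complex_norm_square mult.commute del: of_real_power)
qed

lemma norm_eq_1_if_cinner: "norm v = 1" if "cinner v v = 1"
proof -
  have "(norm v)\<^sup>2 = 1" using that unfolding cinner_self by (metis of_real_eq_1_iff)
  then show ?thesis
    by (simp add: power2_eq_1_iff) (metis norm_ge_zero neg_0_le_iff_le not_one_le_zero)
qed

lemma cinner_axis_left: "cinner (axis i 1) v = v $ i"
  by (simp add: cinner_def axis_def if_distrib if_distribR cong: if_cong)

lemma cinner_axis_right: "cinner v (axis i 1) = cnj (v $ i)"
  using cinner_commute[of v "axis i 1"] by (simp add: cinner_axis_left)

lemma cinner_dagger: "cinner v (A *v w) = cinner (A\<^sup>\<dagger> *v v) w"
proof -
  have "cinner v (A *v w) = (\<Sum>i\<in>UNIV. \<Sum>j\<in>UNIV. cnj (v $ i) * A $ i $ j * w $ j)"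
    by (simp add: cinner_def matrix_vector_mult_def sum_distrib_left mult_ac)
  also have "\<dots> = (\<Sum>j\<in>UNIV. \<Sum>i\<in>UNIV. cnj (v $ i) * A $ i $ j * w $ j)"
    by (rule sum.swap)
  also have "\<dots> = cinner (A\<^sup>\<dagger> *v v) w"
    by (simp add: cinner_def matrix_vector_mult_def dagger_def sum_distrib_left sum_distrib_right mult_ac)
  finally show ?thesis .
qed

lemma dagger_dagger: "(A\<^sup>\<dagger>)\<^sup>\<dagger> = A"
  by (simp add: dagger_def vec_eq_iff)

section \<open>Orthogonal projectors and their traces\<close>

lemma is_projector_onto_subspace:
  assumes "is_projector_onto P V"
  shows "vec.subspace V"
proof -
  have V: "V = range ((*v) P)" using assms by (simp add: is_projector_onto_def)
  have "0 \<in> range ((*v) P)" by (metis matrix_vector_mult_0_right rangeI)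
  moreover have "P *v x + P *v y = P *v (x + y)" for x y
    by (simp add: matrix_vector_right_distrib)
  moreover have "c *s (P *v x) = P *v (c *s x)" for c x
    by (simp add: vec.scale)
  ultimately show ?thesis
    unfolding V vec.subspace_def by auto
qed

lemma ketbra_mult_vec: "ketbra v *v w = cinner v w *s v"
  by (simp add: ketbra_def matrix_vector_mult_def cinner_def vec_eq_iff sum_distrib_left mult_ac)

lemma dagger_ketbra: "(ketbra v)\<^sup>\<dagger> = ketbra v"
  by (simp add: ketbra_def dagger_def vec_eq_iff mult.commute)

lemma mult_ketbra_fixed:
  assumes "P *v v = v"
  shows "P ** ketbra v = ketbra v"
proof -
  have "P ** ketbra v *v w = ketbra v *v w" for w
    by (simp add: ketbra_mult_vec matrix_vector_mul_assoc[symmetric] vec.scale assms)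
  then show ?thesis by (simp add: matrix_eq)
qed

lemma ketbra_mult_fixed:
  assumes "P\<^sup>\<dagger> = P" "P *v v = v"
  shows "ketbra v ** P = ketbra v"
  by (metis assms dagger_ketbra dagger_mult mult_ketbra_fixed)

lemma trace_ketbra: "trace (ketbra v) = cinner v v"
  by (simp add: trace_def ketbra_def cinner_def mult.commute)

text \<open>The operator \<open>ketbra v\<close> projects onto a line inside \<open>V\<close>, so
  subtracting it removes that line and leaves its orthogonal complement in \<open>V\<close>. This is
  the induction step for the trace of a projector.\<close>

lemma is_projector_onto_diff_ketbra:
  assumes P: "is_projector_onto P V" and v: "v \<in> V" "norm v = 1"
  shows "is_projector_onto (P - ketbra v) {w \<in> V. cinner v w = 0}"
proof -
  have PP: "P ** P = P" "P\<^sup>\<dagger> = P" "range ((*v) P) = V"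
    using P by (auto simp: is_projector_onto_def)
  have Pv: "P *v v = v" using is_projector_onto_fix[OF P v(1)] .
  have vv: "cinner v v = 1" using v by (simp add: cinner_self)
  have sub: "vec.subspace V" using is_projector_onto_subspace[OF P] .
  have app: "(P - ketbra v) *v w = P *v w - cinner v w *s v" for w
    by (simp add: matrix_vector_mult_diff_rdistrib ketbra_mult_vec)
  have cP: "cinner v (P *v w) = cinner v w" for w
    by (simp add: cinner_dagger PP Pv)
  have fixed: "(P - ketbra v) *v w = w" if "w \<in> V" "cinner v w = 0" for w
    using that by (simp add: app is_projector_onto_fix[OF P])
  have maps: "(P - ketbra v) *v w \<in> {w \<in> V. cinner v w = 0}" for w
  proof -
    have "P *v w \<in> V" using PP(3) by blast
    then show ?thesis
      using sub v by (simp add: app vec.subspace_diff vec.subspace_scale cinner_diff_right cinner_scale_right cP vv)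
  qed
  have "(P - ketbra v) ** (P - ketbra v) = P - ketbra v"
    unfolding matrix_eq matrix_vector_mul_assoc[symmetric] using maps fixed by blast
  moreover have "(P - ketbra v)\<^sup>\<dagger> = P - ketbra v"
    using PP(2) dagger_ketbra[of v] by (simp add: dagger_def vec_eq_iff)
  moreover have "range ((*v) (P - ketbra v)) = {w \<in> V. cinner v w = 0}"
  proof
    show "{w \<in> V. cinner v w = 0} \<subseteq> range ((*v) (P - ketbra v))"
      using fixed by (metis (mono_tags, lifting) mem_Collect_eq rangeI subsetI)
  qed (use maps in blast)
  ultimately show ?thesis by (simp add: is_projector_onto_def)
qed

lemma subspace_unit_vector:
  fixes V :: "(complex ^ 'a::finite) set"
  assumes V: "vec.subspace V" "V \<noteq> {0}"
  obtains v where "v \<in> V" "norm v = 1"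
proof -
  obtain x where x: "x \<in> V" "x \<noteq> 0"
    using V vec.subspace_0 by blast
  define v where "v = complex_of_real (inverse (norm x)) *s x"
  have "cinner v v = complex_of_real ((inverse (norm x))\<^sup>2 * (norm x)\<^sup>2)"
    unfolding v_def cinner_scale_left cinner_scale_right cinner_self[of x]
    by (simp add: power2_eq_square)
  also have "\<dots> = 1" using x by (simp add: power_mult_distrib[symmetric])
  finally have "norm v = 1" by (rule norm_eq_1_if_cinner)
  moreover have "v \<in> V" using V x by (simp add: v_def vec.subspace_scale)
  ultimately show ?thesis using that by blast
qed

text \<open>Induction on the dimension: splitting off a unit vector lowers both the trace and the
  dimension by one.\<close>

lemma trace_projector:
  assumes "is_projector_onto P V"
  shows "trace P = of_nat (vec.dim V)"
  using assms
proof (induction "vec.dim V" arbitrary: P V rule: less_induct)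
  case less
  note P = less.prems
  have sub: "vec.subspace V" using is_projector_onto_subspace[OF P] .
  show ?case
  proof (cases "V = {0}")
    case True
    then have "P *v x = 0" for x using P by (auto simp: is_projector_onto_def)
    then have "P = 0" by (simp add: matrix_eq)
    then show ?thesis using True by (simp add: trace_def)
  next
    case False
    obtain v where v: "v \<in> V" "norm v = 1" using subspace_unit_vector[OF sub False] .
    define W where "W = {w \<in> V. cinner v w = 0}"
    have W: "is_projector_onto (P - ketbra v) W"
      unfolding W_def by (rule is_projector_onto_diff_ketbra[OF P v])
    have subW: "vec.subspace W" using is_projector_onto_subspace[OF W] .
    have vv: "cinner v v = 1" using v by (simp add: cinner_self)
    then have "v \<notin> vec.span W"
      using subW by (metis (mono_tags, lifting) W_def mem_Collect_eq vec.span_eq_iff zero_neq_one)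
    then have d1: "vec.dim (insert v W) = Suc (vec.dim W)"
      by (simp add: vec.dim_insert)
    have "V \<subseteq> vec.span (insert v W)"
    proof
      fix w assume w: "w \<in> V"
      have "w - cinner v w *s v \<in> W"
        using w v sub by (simp add: W_def vec.subspace_diff vec.subspace_scale cinner_diff_right cinner_scale_right vv)
      then show "w \<in> vec.span (insert v W)"
        unfolding vec.span_insert using vec.span_base by blast
    qed
    moreover have "insert v W \<subseteq> V" using v by (auto simp: W_def)
    ultimately have d2: "vec.dim V = Suc (vec.dim W)"
      using d1 by (metis vec.dim_span vec.span_eq_iff sub vec.span_mono subset_antisym)
    then have "trace (P - ketbra v) = of_nat (vec.dim W)"
      using less.hyps W by simp
    then show ?thesis using d2 vv by (simp add: trace_sub trace_ketbra algebra_simps)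
  qed
qed

section \<open>Polarization of quartic forms\<close>

text \<open>Complex polarization in two stages: the diagonal controls the values
  \<open>D x x y y\<close>, and each symmetric pair of arguments is then polarized separately.
  Applied to a difference, this shows that two such forms agree once they agree on the
  diagonal.\<close>

lemma vanishing_form_polarization:
  fixes D :: "complex ^ 'a \<Rightarrow> complex ^ 'a \<Rightarrow> complex ^ 'a \<Rightarrow> complex ^ 'a \<Rightarrow> complex"
  assumes comm1: "\<And>a c b d. D a c b d = D c a b d"
    and comm2: "\<And>a c b d. D a c b d = D a c d b"
    and add1: "\<And>a a' c b d. D (a + a') c b d = D a c b d + D a' c b d"
    and scale1: "\<And>z a c b d. D (z *s a) c b d = z * D a c b d"
    and add2: "\<And>a c b b' d. D a c (b + b') d = D a c b d + D a c b' d"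
    and scale2: "\<And>z a c b d. D a c (z *s b) d = cnj z * D a c b d"
    and diag: "\<And>v. D v v v v = 0"
  shows "D a c b d = 0"
proof -
  have add1': "D a (c + c') b d = D a c b d + D a c' b d" for a c c' b d
    by (metis comm1 add1)
  have add2': "D a c b (d + d') = D a c b d + D a c b d'" for a c b d d'
    by (metis comm2 add2)
  have scale1': "D a (z *s c) b d = z * D a c b d" for z a c b d
    by (metis comm1 scale1)
  have scale2': "D a c b (z *s d) = cnj z * D a c b d" for z a c b d
    by (metis comm2 scale2)
  note lin = add1 add1' add2 add2' scale1 scale1' scale2 scale2'
  \<comment> \<open>Averaging \<open>z\<^sup>2 D(v, v, v, v)\<close>, with \<open>v = x + z y\<close>, over the fourth roots of unity \<open>z\<close> leaves only the terms in
    which \<open>z\<close> occurs with total weight \<open>2\<close> or \<open>-2\<close>.\<close>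
  have quad: "D x x y y + D y y x x = 0" for x y
  proof -
    define p where "p z = D (x + z *s y) (x + z *s y) (x + z *s y) (x + z *s y)" for z
    have "p 1 + p (-1) - p \<i> - p (-\<i>) = 4 * (D x x y y + D y y x x)"
      unfolding p_def lin by (simp add: algebra_simps)
    then have "4 * (D x x y y + D y y x x) = 0" unfolding p_def diag by simp
    then show ?thesis by (metis mult_eq_0_iff zero_neq_numeral)
  qed
  have xxyy: "D x x y y = 0" for x y
  proof -
    have "D x x y y + D y y x x = 0" by (rule quad)
    \<comment> \<open>Replacing \<open>y\<close> by \<open>(1 + \<i>) *s y\<close> multiplies the
      two terms by \<open>2 * \<i>\<close> and \<open>-2 * \<i>\<close>. Besides the sum, the
      difference of the two terms therefore vanishes too.\<close>
    moreover have "(1 + \<i>)\<^sup>2 * D y y x x + (cnj (1 + \<i>))\<^sup>2 * D x x y y = 0"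
      using quad[of x "(1 + \<i>) *s y"] unfolding lin power2_eq_square by (simp add: mult.assoc add.commute)
    then have "2 * \<i> * (D y y x x - D x x y y) = 0"
      by (simp add: power2_eq_square algebra_simps)
    ultimately show ?thesis by simp
  qed
  \<comment> \<open>Symmetric bilinearity: expanding at \<open>a + c\<close> leaves twice the mixed
    term. The last pair of arguments is treated in the same way afterwards.\<close>
  have xyy: "D a c y y = 0" for a c y
    using xxyy[of "a + c" y] xxyy[of a y] xxyy[of c y] comm1[of c a y y] by (simp add: lin)
  show ?thesis
    using xyy[of a c "b + d"] xyy[of a c b] xyy[of a c d] comm2[of a c d b] by (simp add: lin)
qed

section \<open>Householder reflections of a complex subspace\<close>

text \<open>With squared length 2 for \<open>y\<close>, the usual factor 2 over the squared length
  of the Householder reflection becomes 1. The reflection is self-adjoint and its own inverse, and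
  it moves vectors only along \<open>y\<close>, hence stays within \<open>V\<close>.\<close>

lemma ketbra_reflection:
  assumes V: "vec.subspace V" and y: "y \<in> V" "cinner y y = 2"
  defines "U \<equiv> mat 1 - ketbra y"
  shows "is_unitary U" "U\<^sup>\<dagger> = U" "((*v) U) ` V = V"
proof -
  have app: "U *v x = x - cinner y x *s y" for x
    by (simp add: U_def matrix_vector_mult_diff_rdistrib ketbra_mult_vec)
  have inv: "U *v (U *v x) = x" for x
    by (simp add: app cinner_diff_right cinner_scale_right y vec_eq_iff algebra_simps)
  then have UU: "U ** U = mat 1"
    by (simp add: matrix_eq matrix_vector_mul_assoc[symmetric])
  show dU: "U\<^sup>\<dagger> = U"
    using dagger_ketbra[of y] by (auto simp: U_def dagger_def vec_eq_iff mat_def)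
  show "is_unitary U" by (simp add: is_unitary_def dU UU)
  have maps: "U *v x \<in> V" if "x \<in> V" for x
    using that V y by (simp add: app vec.subspace_diff vec.subspace_scale)
  show "((*v) U) ` V = V"
  proof
    show "V \<subseteq> ((*v) U) ` V" using maps inv by (metis image_eqI subsetI)
  qed (use maps in blast)
qed

text \<open>The unimodular factor \<open>z\<close> makes the inner product of \<open>v\<close> and \<open>z w\<close> real, so that a
  Householder reflection exchanges these two vectors.\<close>

lemma unit_vectors_reflection:
  assumes V: "vec.subspace V" and v: "v \<in> V" "norm v = 1" and w: "w \<in> V" "norm w = 1"
  obtains U z where "is_unitary U" "U\<^sup>\<dagger> = U" "((*v) U) ` V = V" "U *v v = z *s w" "cmod z = 1"
proof -
  define s where "s = cinner w v"
  \<comment> \<open>The phase of the overlap \<open>s\<close>. For orthogonal vectors the overlap is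
    already real, and 1 serves.\<close>
  define z where "z = (if s = 0 then 1 else s / complex_of_real (cmod s))"
  define r where "r = cmod s"
  have z1: "cmod z = 1" by (simp add: z_def norm_divide)
  then have zz: "z * cnj z = 1" by (simp add: complex_norm_square[symmetric])
  have zs: "cnj z * s = complex_of_real r"
  proof (cases "s = 0")
    case False
    have "cnj s * s = complex_of_real r * complex_of_real r"
      using complex_norm_square[of s] by (simp add: r_def power2_eq_square mult.commute)
    then show ?thesis using False by (simp add: z_def r_def)
  qed (simp add: r_def)
  define w' where "w' = z *s w"
  define u where "u = v - w'"
  have vv: "cinner v v = 1" "cinner w w = 1" using v w by (simp_all add: cinner_self)
  have w'v: "cinner w' v = complex_of_real r"
    by (simp add: w'_def cinner_scale_left s_def[symmetric] zs)
  then have vw': "cinner v w' = complex_of_real r"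
    using cinner_commute[of v w'] by simp
  have w'w': "cinner w' w' = 1"
    by (simp add: w'_def cinner_scale_left cinner_scale_right vv zz)
  show ?thesis
  proof (cases "u = 0")
    \<comment> \<open>Here \<open>v\<close> already equals \<open>z *s w\<close>, and there is no
      direction to reflect along; the identity does the job.\<close>
    case True
    have "(mat 1 :: complex ^ 'a ^ 'a)\<^sup>\<dagger> = mat 1"
      by (simp add: dagger_def mat_def vec_eq_iff)
    moreover from this have "is_unitary (mat 1 :: complex ^ 'a ^ 'a)"
      by (simp add: is_unitary_def)
    ultimately show ?thesis
      using True z1 by (intro that[of "mat 1" z]) (simp_all add: u_def w'_def)
  next
    case False
    have uu: "cinner u u = 2 - 2 * complex_of_real r"
      by (simp add: u_def cinner_diff_left cinner_diff_right vv w'v vw' w'w')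
    have uv: "cinner u v = 1 - complex_of_real r"
      by (simp add: u_def cinner_diff_left vv w'v)
    \<comment> \<open>Rescales \<open>u\<close> to squared length 2, the normalization of
      \<open>ketbra_reflection\<close>.\<close>
    define t where "t = complex_of_real (sqrt 2 / norm u)"
    have tt: "cnj t * t * cinner u u = 2"
    proof -
      have "cnj t * t * cinner u u = complex_of_real ((sqrt 2 / norm u)\<^sup>2 * (norm u)\<^sup>2)"
        unfolding t_def cinner_self[of u] by (simp only: power2_eq_square of_real_mult complex_cnj_complex_of_real)
      also have "(sqrt 2 / norm u)\<^sup>2 * (norm u)\<^sup>2 = 2"
        using False by (simp add: power_divide)
      finally show ?thesis by simp
    qed
    define y where "y = t *s u"
    have yV: "y \<in> V"
      using V v w by (simp add: y_def u_def w'_def vec.subspace_diff vec.subspace_scale)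
    have yy: "cinner y y = 2"
      using tt by (simp add: y_def cinner_scale_left cinner_scale_right mult_ac)
    \<comment> \<open>This is where the real overlap enters: it makes the reflection subtract
      exactly \<open>u\<close> from \<open>v\<close>, which leaves \<open>w'\<close>.\<close>
    have "cinner u u = 2 * cinner u v" by (simp add: uu uv)
    then have "cnj t * t * cinner u v = 1" using tt by (simp add: mult.assoc)
    then have "cinner y v *s y = u"
      by (simp add: y_def cinner_scale_left mult_ac)
    then have "(mat 1 - ketbra y) *v v = w'"
      by (simp add: matrix_vector_mult_diff_rdistrib ketbra_mult_vec u_def)
    then show ?thesis
      using ketbra_reflection[OF V yV yy] z1 unfolding w'_def by (intro that)
  qed
qed

section \<open>Bounds and continuity for integrability and measurability\<close>

lemma norm_cinner_le: "cmod (cinner a v) \<le> (\<Sum>k\<in>UNIV. cmod (a $ k)) * norm v"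
  unfolding cinner_def sum_distrib_right
  by (rule order_trans[OF norm_sum], rule sum_mono)
     (simp add: norm_mult mult_left_mono Finite_Cartesian_Product.norm_nth_le)

lemma continuous_on_cinner_right: "continuous_on UNIV (cinner a)"
  unfolding cinner_def by (intro continuous_intros)

lemma continuous_on_cinner_left: "continuous_on UNIV (\<lambda>v. cinner v a)"
  unfolding cinner_def by (intro continuous_intros)

lemma continuous_on_complex_matrix_vector_mult:
  "continuous_on UNIV ((*v) (A :: complex ^ 'a ^ 'b))"
  unfolding matrix_vector_mult_def by (intro continuous_intros)

lemma continuous_on_matrix_matrix_mult:
  fixes f :: "'c::topological_space \<Rightarrow> complex ^ 'a ^ 'b" and g :: "'c \<Rightarrow> complex ^ 'd ^ 'a"
  assumes "continuous_on T f" "continuous_on T g"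
  shows "continuous_on T (\<lambda>x. f x ** g x)"
  unfolding matrix_matrix_mult_def by (intro continuous_intros assms)

lemma continuous_on_ketbra: "continuous_on UNIV ketbra"
  unfolding ketbra_def by (intro continuous_intros)

section \<open>Fourth moments of the uniform measure\<close>

locale uniform_state = prob_space \<mu>
  for \<mu> :: "(complex ^ 'a::finite) measure" +
  fixes C :: "(complex ^ 'a) set" and P :: "complex ^ 'a ^ 'a"
  assumes uniform: "uniform_state_measure C \<mu>"
    and projector: "is_projector_onto P C"
    and nonzero: "C \<noteq> {0}"
begin

lemma sets_eq_borel: "sets \<mu> = sets borel"
  and AE_unit: "AE \<psi> in \<mu>. \<psi> \<in> C \<and> norm \<psi> = 1"
  and distr_unitary: "is_unitary U \<Longrightarrow> ((*v) U) ` C = C \<Longrightarrow> distr \<mu> borel ((*v) U) = \<mu>"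
  using uniform by (auto simp: uniform_state_measure_def)

lemma P_idem: "P ** P = P"
  and P_dagger: "P\<^sup>\<dagger> = P"
  and P_in: "P *v v \<in> C"
  using projector by (auto simp: is_projector_onto_def)

lemma P_fix: "v \<in> C \<Longrightarrow> P *v v = v"
  using is_projector_onto_fix[OF projector] .

lemma subspace: "vec.subspace C"
  using is_projector_onto_subspace[OF projector] .

lemma borel_measurable_continuous: "continuous_on UNIV f \<Longrightarrow> f \<in> borel_measurable \<mu>"
  for f :: "complex ^ 'a \<Rightarrow> 'b::topological_space"
  using borel_measurable_continuous_onI[of f] measurable_cong_sets[OF sets_eq_borel refl] by blast

text \<open>The matrix element of the twofold tensor power of \<open>ketbra \<psi>\<close> between
  the product vectors of \<open>b\<close>, \<open>d\<close> on the left and \<open>a\<close>,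
  \<open>c\<close> on the right. The first two arguments enter linearly, the last two
  conjugate-linearly.\<close>

definition moment_fun :: "complex ^ 'a \<Rightarrow> complex ^ 'a \<Rightarrow> complex ^ 'a \<Rightarrow> complex ^ 'a \<Rightarrow> complex ^ 'a \<Rightarrow> complex"
  where "moment_fun a c b d \<psi> = cinner \<psi> a * cinner \<psi> c * cinner b \<psi> * cinner d \<psi>"

definition moment :: "complex ^ 'a \<Rightarrow> complex ^ 'a \<Rightarrow> complex ^ 'a \<Rightarrow> complex ^ 'a \<Rightarrow> complex"
  where "moment a c b d = (LINT \<psi>|\<mu>. moment_fun a c b d \<psi>)"

lemma continuous_on_moment_fun: "continuous_on UNIV (moment_fun a c b d)"
  unfolding moment_fun_def
  by (intro continuous_intros continuous_on_cinner_right continuous_on_cinner_left)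

lemma measurable_moment_fun: "moment_fun a c b d \<in> borel_measurable \<mu>"
  by (rule borel_measurable_continuous[OF continuous_on_moment_fun])

text \<open>Almost every \<psi> is a unit vector, so the integrand is bounded on a probability
  space.\<close>

lemma integrable_moment_fun: "integrable \<mu> (moment_fun a c b d)"
proof (rule integrable_const_bound[OF _ measurable_moment_fun])
  define n where "n a = (\<Sum>k\<in>UNIV. cmod (a $ k))" for a :: "complex ^ 'a"
  show "AE \<psi> in \<mu>. norm (moment_fun a c b d \<psi>) \<le> n a * n c * n b * n d"
    using AE_unit
  proof eventually_elim
    case (elim \<psi>)
    have "cmod (cinner v \<psi>) \<le> n v" for v
      using norm_cinner_le[of v \<psi>] elim by (simp add: n_def)
    moreover have "cmod (cinner \<psi> v) = cmod (cinner v \<psi>)" for v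
      using cinner_commute[of v \<psi>] by simp
    moreover have "0 \<le> n v" for v by (simp add: n_def sum_nonneg)
    ultimately show ?case
      by (simp add: moment_fun_def norm_mult mult_mono)
  qed
qed

lemma moment_commute_left: "moment a c b d = moment c a b d"
  by (simp add: moment_def moment_fun_def mult_ac)

lemma moment_commute_right: "moment a c b d = moment a c d b"
  by (simp add: moment_def moment_fun_def mult_ac)

lemma moment_add_left: "moment (a + a') c b d = moment a c b d + moment a' c b d"
proof -
  have "moment_fun (a + a') c b d \<psi> = moment_fun a c b d \<psi> + moment_fun a' c b d \<psi>" for \<psi>
    by (simp add: moment_fun_def cinner_add_right algebra_simps)
  then show ?thesis by (simp add: moment_def integrable_moment_fun)
qed

lemma moment_add_right: "moment a c (b + b') d = moment a c b d + moment a c b' d"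
proof -
  have "moment_fun a c (b + b') d \<psi> = moment_fun a c b d \<psi> + moment_fun a c b' d \<psi>" for \<psi>
    by (simp add: moment_fun_def cinner_add_left algebra_simps)
  then show ?thesis by (simp add: moment_def integrable_moment_fun)
qed

lemma moment_scale_left: "moment (z *s a) c b d = z * moment a c b d"
proof -
  have "moment_fun (z *s a) c b d \<psi> = z * moment_fun a c b d \<psi>" for \<psi>
    by (simp add: moment_fun_def cinner_scale_right mult_ac)
  then show ?thesis by (simp add: moment_def)
qed

lemma moment_scale_right: "moment a c (z *s b) d = cnj z * moment a c b d"
proof -
  have "moment_fun a c (z *s b) d \<psi> = cnj z * moment_fun a c b d \<psi>" for \<psi>
    by (simp add: moment_fun_def cinner_scale_left mult_ac)
  then show ?thesis by (simp add: moment_def)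
qed

lemma moment_scale_diag:
  "moment (z *s v) (z *s v) (z *s v) (z *s v) = (z * cnj z)\<^sup>2 * moment v v v v"
proof -
  have "moment a (z *s c) b d = z * moment a c b d" for a c b d
    by (metis moment_commute_left moment_scale_left)
  moreover have "moment a c b (z *s d) = cnj z * moment a c b d" for a c b d
    by (metis moment_commute_right moment_scale_right)
  ultimately show ?thesis
    by (simp add: moment_scale_left moment_scale_right power2_eq_square mult_ac)
qed

text \<open>Invariance of \<mu> allows \<psi> to be replaced by \<open>U *v \<psi>\<close>; taking
  adjoints moves \<open>U\<close> to the fixed arguments.\<close>

lemma moment_unitary:
  assumes U: "is_unitary U" "((*v) U) ` C = C"
  shows "moment a c b d = moment (U\<^sup>\<dagger> *v a) (U\<^sup>\<dagger> *v c) (U\<^sup>\<dagger> *v b) (U\<^sup>\<dagger> *v d)"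
proof -
  have eq: "moment_fun a c b d (U *v \<psi>) =
      moment_fun (U\<^sup>\<dagger> *v a) (U\<^sup>\<dagger> *v c) (U\<^sup>\<dagger> *v b) (U\<^sup>\<dagger> *v d) \<psi>" for \<psi>
    unfolding moment_fun_def by (metis cinner_dagger dagger_dagger)
  have "moment a c b d = (LINT \<psi>|distr \<mu> borel ((*v) U). moment_fun a c b d \<psi>)"
    by (simp add: moment_def distr_unitary[OF U])
  also have "\<dots> = (LINT \<psi>|\<mu>. moment_fun a c b d (U *v \<psi>))"
    by (intro integral_distr borel_measurable_continuous continuous_on_complex_matrix_vector_mult
        borel_measurable_continuous_onI continuous_on_moment_fun)
  finally show ?thesis by (simp add: moment_def eq)
qed

text \<open>A reflection carries \<open>v\<close> to \<open>w\<close> up to a phase, which cancels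
  between the two linear and the two conjugate-linear arguments.\<close>

lemma moment_unit_const:
  assumes "v \<in> C" "norm v = 1" "w \<in> C" "norm w = 1"
  shows "moment v v v v = moment w w w w"
proof -
  obtain U z where U: "is_unitary U" "U\<^sup>\<dagger> = U" "((*v) U) ` C = C" "U *v v = z *s w" "cmod z = 1"
    using unit_vectors_reflection[OF subspace assms] .
  then have "z * cnj z = 1" by (simp add: complex_norm_square[symmetric])
  then show ?thesis
    using moment_unitary[OF U(1,3), of v v v v] U(2,4) by (simp add: moment_scale_diag)
qed

text \<open>The measure is concentrated on \<open>C\<close>, where components orthogonal to
  \<open>C\<close> contribute nothing to the overlaps.\<close>

lemma moment_projector: "moment v v v v = moment (P *v v) (P *v v) (P *v v) (P *v v)"
  unfolding moment_def
proof (intro integral_cong_AE measurable_moment_fun)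
  show "AE \<psi> in \<mu>. moment_fun v v v v \<psi> = moment_fun (P *v v) (P *v v) (P *v v) (P *v v) \<psi>"
    using AE_unit
  proof eventually_elim
    case (elim \<psi>)
    then have "cinner (P *v v) \<psi> = cinner v \<psi>"
      by (metis P_dagger P_fix cinner_dagger)
    moreover from this have "cinner \<psi> (P *v v) = cinner \<psi> v"
      by (metis cinner_commute)
    ultimately show ?case by (simp add: moment_fun_def)
  qed
qed

text \<open>The moment depends only on \<open>P *v v\<close> and is homogeneous of degree 4 in it,
  and \<open>cinner v (P *v v)\<close> is the squared length of \<open>P *v v\<close>. The value at
  the unit vector \<open>u\<close> is the constant of proportionality.\<close>

lemma moment_diag:
  assumes u: "u \<in> C" "norm u = 1"
  shows "moment v v v v = moment u u u u * (cinner v (P *v v))\<^sup>2"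
proof -
  define w where "w = P *v v"
  have wC: "w \<in> C" by (simp add: w_def P_in)
  have cw: "cinner w w = cinner v (P *v v)"
    by (metis w_def cinner_dagger P_dagger P_idem matrix_vector_mul_assoc)
  have "moment w w w w = moment u u u u * (cinner w w)\<^sup>2"
  proof (cases "w = 0")
    case True
    then show ?thesis using moment_scale_left[of 0 w w w w] by (simp add: cinner_def)
  next
    case False
    define r where "r = complex_of_real (norm w)"
    define w' where "w' = inverse r *s w"
    have r: "r \<noteq> 0" using False by (simp add: r_def)
    have w: "w = r *s w'" using r by (simp add: w'_def)
    have cww: "cinner w w = r * cnj r"
      unfolding cinner_self r_def by (simp add: power2_eq_square)
    have "cinner w' w' = 1"
      unfolding w'_def cinner_scale_left cinner_scale_right cww using r by (simp add: field_simps)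
    then have "norm w' = 1" by (rule norm_eq_1_if_cinner)
    moreover have "w' \<in> C" using wC subspace by (simp add: w'_def vec.subspace_scale)
    ultimately have "moment w' w' w' w' = moment u u u u"
      using u moment_unit_const by blast
    then show ?thesis
      unfolding cww using moment_scale_diag[of r w'] by (simp add: w[symmetric])
  qed
  then show ?thesis using moment_projector[of v] cw by (simp add: w_def)
qed

text \<open>Both sides have the symmetries required by \<open>vanishing_form_polarization\<close>
  and agree on the diagonal. The two summands coincide there, hence the division by 2.\<close>

lemma moment_unnormalized:
  assumes u: "u \<in> C" "norm u = 1"
  shows "moment a c b d = moment u u u u / 2 *
    (cinner b (P *v a) * cinner d (P *v c) + cinner d (P *v a) * cinner b (P *v c))"
proof -
  define R where "R a c b d = moment u u u u / 2 *
    (cinner b (P *v a) * cinner d (P *v c) + cinner d (P *v a) * cinner b (P *v c))" for a c b d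
  have "moment a c b d - R a c b d = 0"
  proof (rule vanishing_form_polarization[where D = "\<lambda>a c b d. moment a c b d - R a c b d"])
    show "moment a c b d - R a c b d = moment c a b d - R c a b d" for a c b d
      using moment_commute_left[of a c b d] by (simp add: R_def algebra_simps)
    show "moment a c b d - R a c b d = moment a c d b - R a c d b" for a c b d
      using moment_commute_right[of a c b d] by (simp add: R_def algebra_simps)
    show "moment (a + a') c b d - R (a + a') c b d =
        moment a c b d - R a c b d + (moment a' c b d - R a' c b d)" for a a' c b d
      by (simp add: moment_add_left R_def matrix_vector_right_distrib cinner_add_right algebra_simps)
    show "moment (z *s a) c b d - R (z *s a) c b d = z * (moment a c b d - R a c b d)" for z a c b d
      by (simp add: moment_scale_left R_def vec.scale cinner_scale_right algebra_simps)
    show "moment a c (b + b') d - R a c (b + b') d =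
        moment a c b d - R a c b d + (moment a c b' d - R a c b' d)" for a c b b' d
      by (simp add: moment_add_right R_def cinner_add_left algebra_simps)
    show "moment a c (z *s b) d - R a c (z *s b) d = cnj z * (moment a c b d - R a c b d)" for z a c b d
      by (simp add: moment_scale_right R_def cinner_scale_left algebra_simps)
    show "moment v v v v - R v v v v = 0" for v
      using moment_diag[OF u, of v] by (simp add: R_def power2_eq_square)
  qed
  then show ?thesis by (simp add: R_def)
qed

lemma cinner_axis_projector: "cinner (axis i 1) (P *v axis j 1) = P $ i $ j"
  unfolding cinner_axis_left
  by (simp add: matrix_vector_mult_def axis_def if_distrib cong: if_cong)

text \<open>Summing the basis moments integrates the fourth power of the norm of \<psi>, which is 1
  almost everywhere. The moment formula turns the same sum into the square of the trace of
  \<open>P\<close> plus the trace of \<open>P ** P\<close>.\<close>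

lemma moment_normalization:
  assumes u: "u \<in> C" "norm u = 1"
  shows "moment u u u u / 2 * (of_nat (vec.dim C) * (of_nat (vec.dim C) + 1)) = 1"
proof -
  let ?e = "\<lambda>i. axis i 1 :: complex ^ 'a"
  have "(\<Sum>i\<in>UNIV. \<Sum>j\<in>UNIV. moment (?e i) (?e j) (?e i) (?e j)) =
      (LINT \<psi>|\<mu>. (\<Sum>i\<in>UNIV. \<Sum>j\<in>UNIV. moment_fun (?e i) (?e j) (?e i) (?e j) \<psi>))"
    by (simp add: moment_def integrable_moment_fun)
  also have "\<dots> = (LINT \<psi>|\<mu>. 1)"
  proof (intro integral_cong_AE borel_measurable_sum measurable_moment_fun)
    show "AE \<psi> in \<mu>. (\<Sum>i\<in>UNIV. \<Sum>j\<in>UNIV. moment_fun (?e i) (?e j) (?e i) (?e j) \<psi>) = 1"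
      using AE_unit
    proof eventually_elim
      case (elim \<psi>)
      have "(\<Sum>i\<in>UNIV. \<Sum>j\<in>UNIV. moment_fun (?e i) (?e j) (?e i) (?e j) \<psi>) = cinner \<psi> \<psi> * cinner \<psi> \<psi>"
        unfolding cinner_def[of \<psi> \<psi>] sum_product
        by (simp add: moment_fun_def cinner_axis_left cinner_axis_right mult_ac)
      then show ?case using elim by (simp add: cinner_self)
    qed
  qed simp
  also have "\<dots> = 1" by (simp add: prob_space)
  finally have "1 = (\<Sum>i\<in>UNIV. \<Sum>j\<in>UNIV. moment (?e i) (?e j) (?e i) (?e j))" ..
  also have "\<dots> = (\<Sum>i\<in>UNIV. \<Sum>j\<in>UNIV. moment u u u u / 2 * (P $ i $ i * P $ j $ j + P $ j $ i * P $ i $ j))"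
    by (subst moment_unnormalized[OF u]) (simp add: cinner_axis_projector)
  also have "\<dots> = moment u u u u / 2 * (trace P * trace P + trace (P ** P))"
    by (simp add: trace_def matrix_matrix_mult_def sum_product sum.distrib sum_distrib_left
        algebra_simps)
  finally show ?thesis
    using trace_projector[OF projector] by (simp add: P_idem algebra_simps)
qed

lemma moment_eq:
  "moment a c b d = 1 / (of_nat (vec.dim C) * (of_nat (vec.dim C) + 1)) *
    (cinner b (P *v a) * cinner d (P *v c) + cinner d (P *v a) * cinner b (P *v c))"
proof -
  obtain u where u: "u \<in> C" "norm u = 1"
    using subspace_unit_vector[OF subspace nonzero] .
  \<comment> \<open>That the product in \<open>moment_normalization\<close> is 1 also shows that the
    denominator is nonzero.\<close>
  have "moment u u u u / 2 = 1 / (of_nat (vec.dim C) * (of_nat (vec.dim C) + 1))"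
    using moment_normalization[OF u] by (metis eq_divide_imp mult_zero_right zero_neq_one)
  then show ?thesis by (subst moment_unnormalized[OF u]) simp
qed

section \<open>Averages of products of two expectation values\<close>

lemma cinner_product_expand:
  "cinner \<psi> (A *v \<psi>) * cinner \<psi> (B *v \<psi>) =
    (\<Sum>i\<in>UNIV. \<Sum>j\<in>UNIV. \<Sum>k\<in>UNIV. \<Sum>l\<in>UNIV. A $ i $ j * B $ k $ l *
      moment_fun (axis i 1) (axis k 1) (axis j 1) (axis l 1) \<psi>)"
proof -
  have e: "cinner \<psi> (M *v \<psi>) = (\<Sum>i\<in>UNIV. \<Sum>j\<in>UNIV. M $ i $ j * (cnj (\<psi> $ i) * \<psi> $ j))" for M
    by (simp add: cinner_def matrix_vector_mult_def sum_distrib_left mult_ac)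
  show ?thesis
    unfolding e moment_fun_def cinner_axis_left cinner_axis_right sum_distrib_right
    unfolding sum_distrib_left by (simp add: mult_ac)
qed

lemma integrable_cinner_product: "integrable \<mu> (\<lambda>\<psi>. cinner \<psi> (A *v \<psi>) * cinner \<psi> (B *v \<psi>))"
  unfolding cinner_product_expand
  by (intro Bochner_Integration.integrable_sum integrable_mult_right integrable_moment_fun)

text \<open>The two summands of \<open>moment_eq\<close> contract the indices of \<open>A\<close>
  and \<open>B\<close> in two ways: each matrix with itself, giving a product of traces, or
  crosswise, giving a single trace.\<close>

lemma integral_cinner_product:
  "(LINT \<psi>|\<mu>. cinner \<psi> (A *v \<psi>) * cinner \<psi> (B *v \<psi>)) =
    1 / (of_nat (vec.dim C) * (of_nat (vec.dim C) + 1)) *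
    (trace (A ** P) * trace (B ** P) + trace (A ** P ** B ** P))"
proof -
  let ?e = "\<lambda>i. axis i 1 :: complex ^ 'a"
  let ?c = "1 / (of_nat (vec.dim C) * (of_nat (vec.dim C) + 1)) :: complex"
  have "(LINT \<psi>|\<mu>. cinner \<psi> (A *v \<psi>) * cinner \<psi> (B *v \<psi>)) =
      (\<Sum>i\<in>UNIV. \<Sum>j\<in>UNIV. \<Sum>k\<in>UNIV. \<Sum>l\<in>UNIV. A $ i $ j * B $ k $ l * moment (?e i) (?e k) (?e j) (?e l))"
    unfolding cinner_product_expand moment_def
    by (simp add: Bochner_Integration.integral_sum Bochner_Integration.integrable_sum
        integrable_moment_fun)
  also have "\<dots> = (\<Sum>i\<in>UNIV. \<Sum>j\<in>UNIV. \<Sum>k\<in>UNIV. \<Sum>l\<in>UNIV.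
      ?c * ((A $ i $ j * P $ j $ i) * (B $ k $ l * P $ l $ k)) +
      ?c * (A $ i $ j * P $ j $ k * B $ k $ l * P $ l $ i))"
    unfolding moment_eq cinner_axis_projector by (simp only: distrib_left mult_ac)
  also have "\<dots> = ?c * (\<Sum>i\<in>UNIV. \<Sum>j\<in>UNIV. \<Sum>k\<in>UNIV. \<Sum>l\<in>UNIV. (A $ i $ j * P $ j $ i) * (B $ k $ l * P $ l $ k)) +
      ?c * (\<Sum>i\<in>UNIV. \<Sum>j\<in>UNIV. \<Sum>k\<in>UNIV. \<Sum>l\<in>UNIV. A $ i $ j * P $ j $ k * B $ k $ l * P $ l $ i)"
    by (simp only: sum.distrib sum_distrib_left)
  also have "(\<Sum>i\<in>UNIV. \<Sum>j\<in>UNIV. \<Sum>k\<in>UNIV. \<Sum>l\<in>UNIV. (A $ i $ j * P $ j $ i) * (B $ k $ l * P $ l $ k)) =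
      trace (A ** P) * trace (B ** P)"
    by (simp add: trace_def matrix_matrix_mult_def sum_distrib_left[symmetric] sum_distrib_right[symmetric])
  also have "(\<Sum>i\<in>UNIV. \<Sum>j\<in>UNIV. \<Sum>k\<in>UNIV. \<Sum>l\<in>UNIV. A $ i $ j * P $ j $ k * B $ k $ l * P $ l $ i) =
      trace (A ** (P ** (B ** P)))"
    by (simp add: trace_def matrix_matrix_mult_def sum_distrib_left mult_ac)
  finally show ?thesis by (simp add: distrib_left matrix_mul_assoc)
qed

end

section \<open>Diagonal operators and the projector onto their common fixed space\<close>

lemma diagonal_commute:
  assumes "is_diagonal A" "is_diagonal B"
  shows "A ** B = B ** (A :: complex ^ 'a::finite ^ 'a)"
proof -
  have "(\<Sum>k\<in>UNIV. A $ i $ k * B $ k $ j) = (\<Sum>k\<in>UNIV. B $ i $ k * A $ k $ j)" for i j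
    using assms by (intro sum.cong refl) (metis is_diagonal_def mult.commute mult_zero_left mult_zero_right)
  then show ?thesis by (simp add: matrix_matrix_mult_def vec_eq_iff)
qed

lemma is_diagonal_dagger: "is_diagonal A \<Longrightarrow> is_diagonal (A\<^sup>\<dagger>)"
  by (simp add: is_diagonal_def dagger_def)

text \<open>Diagonal operators fix a vector exactly when it is supported on the coordinates where
  all their diagonal entries are 1. The coordinate projector \<open>Q\<close> onto these is thus the
  projector in question, by uniqueness.\<close>

lemma is_diagonal_projector_fixed_space:
  fixes D :: "(complex ^ 'a::finite ^ 'a) set"
  assumes D: "\<And>g. g \<in> D \<Longrightarrow> is_diagonal g"
  shows "is_diagonal (projector (fixed_space D))"
proof -
  define Q :: "complex ^ 'a ^ 'a"
    where "Q = (\<chi> i j. if i = j \<and> (\<forall>g\<in>D. g $ i $ i = 1) then 1 else 0)"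
  have app: "(Q *v v) $ i = (if \<forall>g\<in>D. g $ i $ i = 1 then v $ i else 0)" for v i
    by (auto simp: Q_def matrix_vector_mult_def if_distrib if_distribR cong: if_cong)
  have dapp: "(g *v v) $ i = g $ i $ i * v $ i" if "g \<in> D" for g v i
  proof -
    have "(g *v v) $ i = (\<Sum>j\<in>UNIV. if j = i then g $ i $ i * v $ i else 0)"
      using D[OF that] unfolding matrix_vector_mult_def vec_lambda_beta
      by (intro sum.cong refl) (auto simp: is_diagonal_def)
    then show ?thesis by simp
  qed
  have mem: "v \<in> fixed_space D \<longleftrightarrow> (\<forall>i. v $ i \<noteq> 0 \<longrightarrow> (\<forall>g\<in>D. g $ i $ i = 1))" for v
    by (auto simp: fixed_space_def vec_eq_iff dapp)
  have "Q *v (Q *v v) = Q *v v" for v by (simp add: vec_eq_iff app)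
  then have "Q ** Q = Q" by (simp add: matrix_eq matrix_vector_mul_assoc[symmetric])
  moreover have "Q\<^sup>\<dagger> = Q" by (auto simp: Q_def dagger_def vec_eq_iff)
  moreover have "range ((*v) Q) = fixed_space D"
  proof
    show "range ((*v) Q) \<subseteq> fixed_space D" by (auto simp: mem app split: if_splits)
    have "Q *v v = v" if "v \<in> fixed_space D" for v
      using that by (auto simp: mem vec_eq_iff app)
    then show "fixed_space D \<subseteq> range ((*v) Q)" by (metis rangeI subsetI)
  qed
  ultimately have "is_projector_onto Q (fixed_space D)" by (simp add: is_projector_onto_def)
  then have "projector (fixed_space D) = Q"
    using is_projector_onto_unique projector_correct[OF subspace_fixed_space] by blast
  then show ?thesis by (simp add: is_diagonal_def Q_def)
qed

section \<open>Traces of products with rank-one operators\<close>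

lemma ketbra_sandwich: "ketbra v ** A ** ketbra v = (\<chi> i j. cinner v (A *v v) * ketbra v $ i $ j)"
proof -
  have "ketbra v ** A ** ketbra v *v w = (\<chi> i j. cinner v (A *v v) * ketbra v $ i $ j) *v w" for w
  proof -
    have "(\<chi> i j. cinner v (A *v v) * ketbra v $ i $ j) *v w = cinner v (A *v v) *s (ketbra v *v w)"
      unfolding matrix_vector_mult_def vec_eq_iff vector_smult_component vec_lambda_beta sum_distrib_left
      by (simp add: mult.assoc)
    then show ?thesis
      by (simp add: matrix_vector_mul_assoc[symmetric] ketbra_mult_vec vec.scale cinner_scale_right mult.commute)
  qed
  then show ?thesis by (simp add: matrix_eq)
qed

lemma trace_ketbra_mult: "trace (ketbra v ** A) = cinner v (A *v v)"
  by (simp add: trace_def ketbra_def matrix_matrix_mult_def cinner_def matrix_vector_mult_def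
      sum_distrib_left mult_ac) (rule sum.swap)

text \<open>Compressing \<open>A\<close> to the line of \<open>v\<close> leaves its expectation
  value as a scalar factor. This gives the integrand the shape handled by
  \<open>integral_cinner_product\<close>.\<close>

lemma trace_ketbra_ketbra: "trace (ketbra v ** A ** ketbra v ** B) = cinner v (A *v v) * cinner v (B *v v)"
proof -
  have "trace ((\<chi> i j. c * M $ i $ j) ** B) = c * trace (M ** B)" for c and M :: "complex ^ 'a ^ 'a"
    by (simp add: trace_def matrix_matrix_mult_def sum_distrib_left mult.assoc)
  then show ?thesis by (simp add: ketbra_sandwich trace_ketbra_mult)
qed

section \<open>The two-round probability as an average of products of expectation values\<close>

theorem mainTheorem3:
  fixes N :: nat
    and S :: "('n::finite) operator set"
    and C :: "'n state set"
    and \<Pi>\<^sub>C \<Pi>\<^sub>Z E\<^sub>s\<^sub>z E\<^sub>s\<^sub>x \<Pi>\<^sub>s\<^sub>z \<Pi>\<^sub>s\<^sub>x L E\<^sub>s \<Pi>\<^sub>s :: "'n operator"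
    and K :: "4 \<Rightarrow> qubit_op"
    and \<mu> :: "'n state measure"
    and d :: nat
  assumes "N \<ge> 2"
    and "subgroup S (xp_group N)"
    and "C = fixed_space S"
    and "C \<noteq> {0}"
    and "xp_regular N S"
    and "d = vec.dim C"
    and "\<Pi>\<^sub>C = projector C"
    and "\<Pi>\<^sub>Z = projector (fixed_space {g \<in> S. is_diagonal g})"
    and "is_channel K"
    and "is_unitary E\<^sub>s\<^sub>z"
    and "is_unitary E\<^sub>s\<^sub>x" and "is_diagonal E\<^sub>s\<^sub>x"
    and "\<Pi>\<^sub>s\<^sub>z = E\<^sub>s\<^sub>z ** \<Pi>\<^sub>Z ** E\<^sub>s\<^sub>z\<^sup>\<dagger>"
    and "\<Pi>\<^sub>s\<^sub>x = E\<^sub>s\<^sub>x ** \<Pi>\<^sub>C ** E\<^sub>s\<^sub>x\<^sup>\<dagger>"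
    and "unitary_logical C L"
    and "E\<^sub>s = E\<^sub>s\<^sub>z ** E\<^sub>s\<^sub>x ** L"
    and "\<Pi>\<^sub>s = E\<^sub>s ** \<Pi>\<^sub>C ** E\<^sub>s\<^sup>\<dagger>"
    and "uniform_state_measure C \<mu>"
  shows
    "(LINT \<psi>|\<mu>. (\<Sum>i\<in>UNIV.
        trace (L ** ketbra \<psi> ** L\<^sup>\<dagger> ** E\<^sub>s\<^sub>x\<^sup>\<dagger> ** \<Pi>\<^sub>s\<^sub>x ** E\<^sub>s\<^sub>z\<^sup>\<dagger> ** \<Pi>\<^sub>s\<^sub>z ** kraus_tensor K i
               ** ketbra \<psi> ** (kraus_tensor K i)\<^sup>\<dagger> ** \<Pi>\<^sub>s\<^sub>z ** E\<^sub>s\<^sub>z ** \<Pi>\<^sub>s\<^sub>x ** E\<^sub>s\<^sub>x)))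
     = 1 / (of_nat d * (of_nat d + 1)) *
       ((\<Sum>i\<in>UNIV. trace (kraus_tensor K i ** \<Pi>\<^sub>C ** (kraus_tensor K i)\<^sup>\<dagger> ** \<Pi>\<^sub>s))
        + (\<Sum>i\<in>UNIV. trace (kraus_tensor K i ** \<Pi>\<^sub>C ** E\<^sub>s\<^sup>\<dagger>)
                     * trace ((kraus_tensor K i)\<^sup>\<dagger> ** E\<^sub>s ** \<Pi>\<^sub>C)))"
proof -
  interpret uniform_state \<mu> C \<Pi>\<^sub>C
  proof (rule uniform_state.intro)
    show "prob_space \<mu>" using assms(18) by (simp add: uniform_state_measure_def)
    show "uniform_state_axioms \<mu> C \<Pi>\<^sub>C"
      using assms(3,4,7,18) projector_correct[OF subspace_fixed_space]
      by (simp add: uniform_state_axioms_def)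
  qed
  let ?P = "\<Pi>\<^sub>C" and ?Z = "\<Pi>\<^sub>Z" and ?x = "E\<^sub>s\<^sub>x" and ?z = "E\<^sub>s\<^sub>z"
  let ?K = "kraus_tensor K"
  let ?A = "\<lambda>i. E\<^sub>s\<^sup>\<dagger> ** ?K i" and ?B = "\<lambda>i. (?K i)\<^sup>\<dagger> ** E\<^sub>s"
  have Z: "is_projector_onto ?Z (fixed_space {g \<in> S. is_diagonal g})"
    unfolding assms(8) by (rule projector_correct[OF subspace_fixed_space])
  have Zd: "?Z\<^sup>\<dagger> = ?Z" using Z by (simp add: is_projector_onto_def)
  \<comment> \<open>Code states are fixed by all of \<open>S\<close>, in particular by its diagonal
    elements, so \<open>\<Pi>\<^sub>Z\<close> acts as the identity on the range of
    \<open>\<Pi>\<^sub>C\<close>.\<close>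
  have "v \<in> fixed_space {g \<in> S. is_diagonal g}" if "v \<in> C" for v
    using that assms(3) by (auto simp: fixed_space_def)
  then have ZP: "?Z ** ?P = ?P"
    using is_projector_onto_fix[OF Z] P_in by (simp add: matrix_eq matrix_vector_mul_assoc[symmetric])
  have PZ: "?P ** ?Z = ?P" by (metis ZP Zd P_dagger dagger_mult)
  have diagZ: "is_diagonal ?Z" unfolding assms(8) by (rule is_diagonal_projector_fixed_space) simp
  have Zx: "?Z ** ?x = ?x ** ?Z" by (rule diagonal_commute[OF diagZ assms(12)])
  have xZ: "?x\<^sup>\<dagger> ** ?Z = ?Z ** ?x\<^sup>\<dagger>" by (rule diagonal_commute[OF is_diagonal_dagger[OF assms(12)] diagZ])
  have x: "?x\<^sup>\<dagger> ** ?x = mat 1" and z: "?z\<^sup>\<dagger> ** ?z = mat 1"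
    using assms(10,11) by (simp_all add: is_unitary_def)
  have LP: "L ** ?P = ?P ** L" using assms(7,15) by (simp add: unitary_logical_def)
  have LdP: "L\<^sup>\<dagger> ** ?P = ?P ** L\<^sup>\<dagger>" by (metis LP P_dagger dagger_mult)
  \<comment> \<open>Since \<open>L\<close> preserves the code, cyclicity carries a trailing code
    projector to the front, where it can be absorbed by \<open>ketbra \<psi>\<close>.\<close>
  have cyc: "trace (L ** (Y ** ?P)) = trace (?P ** (Y ** L))" for Y
  proof -
    have "trace (L ** (Y ** ?P)) = trace (Y ** ?P ** L)" by (rule trace_mul_sym)
    also have "Y ** ?P ** L = Y ** L ** ?P" by (simp only: matrix_mul_assoc[symmetric] LP)
    also have "trace (Y ** L ** ?P) = trace (?P ** (Y ** L))" by (rule trace_mul_sym)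
    finally show ?thesis .
  qed
  \<comment> \<open>The projector \<open>\<Pi>\<^sub>Z\<close> slides past the diagonal
    \<open>E\<^sub>s\<^sub>x\<close> and disappears into \<open>\<Pi>\<^sub>C\<close>; the fact
    \<open>right\<close> is the mirror image.\<close>
  have left: "?x\<^sup>\<dagger> ** \<Pi>\<^sub>s\<^sub>x ** ?z\<^sup>\<dagger> ** \<Pi>\<^sub>s\<^sub>z = ?P ** ?x\<^sup>\<dagger> ** ?z\<^sup>\<dagger>"
  proof -
    have "?x\<^sup>\<dagger> ** \<Pi>\<^sub>s\<^sub>x = ?P ** ?x\<^sup>\<dagger>" by (simp add: assms(14) matrix_mul_assoc x)
    moreover have "?z\<^sup>\<dagger> ** \<Pi>\<^sub>s\<^sub>z = ?Z ** ?z\<^sup>\<dagger>" by (simp add: assms(13) matrix_mul_assoc z)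
    ultimately have "?x\<^sup>\<dagger> ** \<Pi>\<^sub>s\<^sub>x ** ?z\<^sup>\<dagger> ** \<Pi>\<^sub>s\<^sub>z = ?P ** (?x\<^sup>\<dagger> ** ?Z) ** ?z\<^sup>\<dagger>"
      by (metis matrix_mul_assoc)
    then show ?thesis by (simp add: xZ matrix_mul_assoc PZ)
  qed
  have right: "\<Pi>\<^sub>s\<^sub>z ** ?z ** \<Pi>\<^sub>s\<^sub>x ** ?x = ?z ** ?x ** ?P"
  proof -
    have "\<Pi>\<^sub>s\<^sub>x ** ?x = ?x ** ?P" by (metis assms(14) matrix_mul_assoc matrix_mul_rid x)
    moreover have "\<Pi>\<^sub>s\<^sub>z ** ?z = ?z ** ?Z" by (metis assms(13) matrix_mul_assoc matrix_mul_rid z)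
    ultimately have "\<Pi>\<^sub>s\<^sub>z ** ?z ** \<Pi>\<^sub>s\<^sub>x ** ?x = ?z ** (?Z ** ?x) ** ?P"
      by (metis matrix_mul_assoc)
    also have "\<dots> = ?z ** ?x ** (?Z ** ?P)" by (metis Zx matrix_mul_assoc)
    finally show ?thesis by (simp add: ZP)
  qed
  have integrand: "trace (L ** ketbra \<psi> ** L\<^sup>\<dagger> ** ?x\<^sup>\<dagger> ** \<Pi>\<^sub>s\<^sub>x ** ?z\<^sup>\<dagger> ** \<Pi>\<^sub>s\<^sub>z ** ?K i
               ** ketbra \<psi> ** (?K i)\<^sup>\<dagger> ** \<Pi>\<^sub>s\<^sub>z ** ?z ** \<Pi>\<^sub>s\<^sub>x ** ?x)
      = cinner \<psi> (?A i *v \<psi>) * cinner \<psi> (?B i *v \<psi>)" (is "trace ?T = _") if "\<psi> \<in> C" for \<psi> i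
  proof -
    have k: "ketbra \<psi> ** ?P = ketbra \<psi>" "?P ** ketbra \<psi> = ketbra \<psi>"
      using ketbra_mult_fixed mult_ketbra_fixed P_dagger P_fix[OF that] by blast+
    have "?T = L ** (ketbra \<psi> ** L\<^sup>\<dagger> ** (?x\<^sup>\<dagger> ** \<Pi>\<^sub>s\<^sub>x ** ?z\<^sup>\<dagger> ** \<Pi>\<^sub>s\<^sub>z) ** ?K i
        ** ketbra \<psi> ** (?K i)\<^sup>\<dagger> ** (\<Pi>\<^sub>s\<^sub>z ** ?z ** \<Pi>\<^sub>s\<^sub>x ** ?x))"
      by (simp only: matrix_mul_assoc)
    also have "\<dots> = L ** ((ketbra \<psi> ** (L\<^sup>\<dagger> ** ?P) ** ?x\<^sup>\<dagger> ** ?z\<^sup>\<dagger> ** ?K i ** ketbra \<psi> ** (?K i)\<^sup>\<dagger> ** ?z ** ?x) ** ?P)"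
      unfolding left right by (simp only: matrix_mul_assoc)
    also have "ketbra \<psi> ** (L\<^sup>\<dagger> ** ?P) = ketbra \<psi> ** L\<^sup>\<dagger>"
      unfolding LdP by (simp add: matrix_mul_assoc k)
    finally have "trace ?T = trace (?P ** (ketbra \<psi> ** L\<^sup>\<dagger> ** ?x\<^sup>\<dagger> ** ?z\<^sup>\<dagger> ** ?K i ** ketbra \<psi> ** (?K i)\<^sup>\<dagger> ** ?z ** ?x ** L))"
      by (simp only: cyc)
    also have "?P ** (ketbra \<psi> ** L\<^sup>\<dagger> ** ?x\<^sup>\<dagger> ** ?z\<^sup>\<dagger> ** ?K i ** ketbra \<psi> ** (?K i)\<^sup>\<dagger> ** ?z ** ?x ** L)
        = ketbra \<psi> ** ?A i ** ketbra \<psi> ** ?B i"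
      by (simp add: matrix_mul_assoc k assms(16) dagger_mult)
    finally show ?thesis by (simp add: trace_ketbra_ketbra)
  qed
  have "(LINT \<psi>|\<mu>. (\<Sum>i\<in>UNIV. trace (L ** ketbra \<psi> ** L\<^sup>\<dagger> ** ?x\<^sup>\<dagger> ** \<Pi>\<^sub>s\<^sub>x ** ?z\<^sup>\<dagger> ** \<Pi>\<^sub>s\<^sub>z ** ?K i
               ** ketbra \<psi> ** (?K i)\<^sup>\<dagger> ** \<Pi>\<^sub>s\<^sub>z ** ?z ** \<Pi>\<^sub>s\<^sub>x ** ?x))) =
      (LINT \<psi>|\<mu>. (\<Sum>i\<in>UNIV. cinner \<psi> (?A i *v \<psi>) * cinner \<psi> (?B i *v \<psi>)))"
  \<comment> \<open>The simplified integrand is valid only for \<psi> in \<open>C\<close>, which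
    holds almost everywhere; both sides therefore need measurability on the whole ambient
    space.\<close>
  proof (rule integral_cong_AE)
    show "(\<lambda>\<psi>. \<Sum>i\<in>UNIV. trace (L ** ketbra \<psi> ** L\<^sup>\<dagger> ** ?x\<^sup>\<dagger> ** \<Pi>\<^sub>s\<^sub>x ** ?z\<^sup>\<dagger> ** \<Pi>\<^sub>s\<^sub>z ** ?K i
               ** ketbra \<psi> ** (?K i)\<^sup>\<dagger> ** \<Pi>\<^sub>s\<^sub>z ** ?z ** \<Pi>\<^sub>s\<^sub>x ** ?x)) \<in> borel_measurable \<mu>"
      unfolding trace_def
      by (intro borel_measurable_continuous continuous_on_sum continuous_on_component
          continuous_on_matrix_matrix_mult
          continuous_on_ketbra continuous_on_const)
    show "(\<lambda>\<psi>. \<Sum>i\<in>UNIV. cinner \<psi> (?A i *v \<psi>) * cinner \<psi> (?B i *v \<psi>)) \<in> borel_measurable \<mu>"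
      by (intro borel_measurable_sum borel_measurable_integrable integrable_cinner_product)
  qed (use AE_unit in eventually_elim, simp add: integrand)
  also have "\<dots> = (\<Sum>i\<in>UNIV. LINT \<psi>|\<mu>. cinner \<psi> (?A i *v \<psi>) * cinner \<psi> (?B i *v \<psi>))"
    by (rule Bochner_Integration.integral_sum) (rule integrable_cinner_product)
  also have "\<dots> = 1 / (of_nat d * (of_nat d + 1)) * (\<Sum>i\<in>UNIV.
      trace (?K i ** ?P ** (?K i)\<^sup>\<dagger> ** \<Pi>\<^sub>s) + trace (?K i ** ?P ** E\<^sub>s\<^sup>\<dagger>) * trace ((?K i)\<^sup>\<dagger> ** E\<^sub>s ** ?P))"
  proof -
    \<comment> \<open>Cycling \<open>E\<^sub>s\<^sup>\<dagger>\<close> to the end completes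
      \<open>E\<^sub>s ** \<Pi>\<^sub>C ** E\<^sub>s\<^sup>\<dagger>\<close>, which is
      \<open>\<Pi>\<^sub>s\<close>, in the crosswise term.\<close>
    have "trace (?A i ** ?P) = trace (?K i ** ?P ** E\<^sub>s\<^sup>\<dagger>)"
      and "trace (?A i ** ?P ** ?B i ** ?P) = trace (?K i ** ?P ** (?K i)\<^sup>\<dagger> ** \<Pi>\<^sub>s)" for i
      using trace_mul_sym[of "E\<^sub>s\<^sup>\<dagger>" "?K i ** ?P"]
        trace_mul_sym[of "E\<^sub>s\<^sup>\<dagger>" "?K i ** ?P ** (?K i)\<^sup>\<dagger> ** E\<^sub>s ** ?P"]
      by (simp_all only: assms(17) matrix_mul_assoc)
    then show ?thesis
      by (simp only: integral_cinner_product assms(6) sum_distrib_left add.commute)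
  qed
  finally show ?thesis by (simp only: sum.distrib)
qed

end
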